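(* Let $S$ be a nontrivial proper subgroup of $\mathbb{Q}$, let $u,v\in\mathbb{N}$, and let $A$ be a $u\times v$ matrix with rational entries that is weakly image partition regular over $S$ and has linearly dependent rows. Then there exist $j<u$ and a $(j+u)\times 3u$ matrix $D$ (with rational entries) that is kernel partition regular over $S$ such that, whenever $\vec s\in(S\setminus\{0\})^{3u}$ and $D\vec s=\vec 0$, there exists $\vec y\in S^v\setminus\{\vec 0\}$ such that all entries of $A\vec y$ are entries of $\vec s$.
   Context: $\mathbb{N}$ is the set of positive integers; nontrivial means $\neq\{0\}$. A finite colouring is a function with finite range; monochromatic means constant colour. $A$ is weakly image partition regular over $S$ (a group) if for every finite colouring of $S\setminus\{0\}$ there is $\vec x\in S^v$ with the entries of $A\vec x$ in $S\setminus\{0\}$ and monochromatic. A matrix $M$ with $w$ columns is kernel partition regular over $S$ if for every finite colouring of $S\setminus\{0\}$ there is $\vec x\in(S\setminus\{0\})^w$ with $M\vec x=\vec 0$ and the entries of $\vec x$ monochromatic. *)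

theory Defs
  imports "Jordan_Normal_Form.VS_Connect" "HOL-Algebra.AbelCoset"
begin

definition vecs_over :: "rat set \<Rightarrow> nat \<Rightarrow> rat vec set" where
  "vecs_over T n = {x \<in> carrier_vec n. set\<^sub>v x \<subseteq> T}"

text \<open>Only the restriction of the colouring to the set in question matters; since its range there
  is finite, natural numbers suffice as colours.\<close>

definition finite_colouring :: "(rat \<Rightarrow> nat) \<Rightarrow> rat set \<Rightarrow> bool" where
  "finite_colouring c T \<longleftrightarrow> finite (c ` T)"

definition monochromatic :: "(rat \<Rightarrow> nat) \<Rightarrow> rat set \<Rightarrow> bool" where
  "monochromatic c T \<longleftrightarrow> (\<exists>k. \<forall>t\<in>T. c t = k)"

definition weakly_image_partition_regular :: "rat mat \<Rightarrow> rat set \<Rightarrow> bool" where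
  "weakly_image_partition_regular A S \<longleftrightarrow>
     (\<forall>c. finite_colouring c (S - {0}) \<longrightarrow>
       (\<exists>x \<in> vecs_over S (dim_col A).
          set\<^sub>v (A *\<^sub>v x) \<subseteq> S - {0} \<and> monochromatic c (set\<^sub>v (A *\<^sub>v x))))"

definition kernel_partition_regular :: "rat mat \<Rightarrow> rat set \<Rightarrow> bool" where
  "kernel_partition_regular M S \<longleftrightarrow>
     (\<forall>c. finite_colouring c (S - {0}) \<longrightarrow>
       (\<exists>x \<in> vecs_over (S - {0}) (dim_col M).
          M *\<^sub>v x = 0\<^sub>v (dim_row M) \<and> monochromatic c (set\<^sub>v x)))"

text \<open>Dependence of the rows as an indexed family: a repeated row makes the rows dependent,
  which dependence of the set of rows would not capture.\<close>

definition rows_linearly_dependent :: "rat mat \<Rightarrow> bool" where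
  "rows_linearly_dependent A \<longleftrightarrow>
     (\<exists>a. (\<exists>i<dim_row A. a i \<noteq> 0) \<and>
          (\<forall>k<dim_col A. (\<Sum>i<dim_row A. a i * A $$ (i, k)) = 0))"

end

theory Submission
  imports Defs "HOL-Analysis.Function_Topology" "Jordan_Normal_Form.Gauss_Jordan_Elimination"
begin

text \<open>
  Let \<open>B\<close> be a generalised inverse of \<open>A\<close>, i.e. \<open>A B A = A\<close>. Then \<open>A B\<close> is idempotent, the
  kernel of \<open>1 - A B\<close> is the column space of \<open>A\<close>, and a nonzero row of \<open>A B\<close> is a linear
  dependence between the rows of \<open>1 - A B\<close>. Deleting a redundant row from \<open>1 - A B\<close> gives \<open>N\<close>
  with \<open>j = u - 1\<close> rows and the same kernel. If \<open>d B\<close> is an integer matrix, let \<open>D\<close> express, for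
  \<open>s = (a, b, c)\<close>, that \<open>N a = 0\<close> and \<open>a = d (b - c)\<close>. Then \<open>y = B a = d B (b - c)\<close> lies in
  \<open>S\<^sup>v\<close> and \<open>A y = a\<close>.

  For partition regularity of \<open>D\<close>, compactness gives a finite \<open>F\<close> such that every colouring of
  \<open>S\<close> with the given number of colours has a monochromatic image of \<open>A\<close> inside \<open>F\<close>. Colour a
  positive integer \<open>n\<close> by the colours of all \<open>n f\<close> with \<open>f \<in> F\<close>, and find \<open>x\<close>, \<open>x + t\<close>, \<open>d t\<close> of
  one colour. A monochromatic image \<open>a\<close> for the colouring \<open>f \<mapsto> c (x f)\<close> then yields the
  monochromatic solution \<open>(d t a, (x + t) a, x a)\<close>.
\<close>

section \<open>Compactness of colourings\<close>

lemma openin_product_discrete_constant_on: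
  assumes "finite E" and "E \<subseteq> X"
  shows "openin (product_topology (\<lambda>_. discrete_topology C) X) {c \<in> X \<rightarrow>\<^sub>E C. c constant_on E}"
proof -
  let ?T = "product_topology (\<lambda>_. discrete_topology C) X"
  have "openin ?T {c \<in> X \<rightarrow>\<^sub>E C. \<forall>x\<in>E. c x = k}" for k
  proof -
    have "finite {x \<in> X. (if x \<in> E then {k} \<inter> C else C) \<noteq> C}"
      using \<open>finite E\<close> by (auto intro: rev_finite_subset)
    then have "openin ?T (\<Pi>\<^sub>E x\<in>X. if x \<in> E then {k} \<inter> C else C)"
      by (auto simp: openin_PiE_gen)
    also have "(\<Pi>\<^sub>E x\<in>X. if x \<in> E then {k} \<inter> C else C) = {c \<in> X \<rightarrow>\<^sub>E C. \<forall>x\<in>E. c x = k}"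
      using \<open>E \<subseteq> X\<close> by (auto simp: PiE_iff extensional_def split: if_splits)
    finally show ?thesis .
  qed
  moreover have "{c \<in> X \<rightarrow>\<^sub>E C. c constant_on E} = (\<Union>k. {c \<in> X \<rightarrow>\<^sub>E C. \<forall>x\<in>E. c x = k})"
    by (auto simp: constant_on_def)
  ultimately show ?thesis
    by auto
qed

lemma constant_on_compactness:
  assumes "finite C"
    and finite_subset: "\<And>E. E \<in> \<A> \<Longrightarrow> finite E \<and> E \<subseteq> X"
    and constant_on: "\<And>c. c \<in> X \<rightarrow> C \<Longrightarrow> \<exists>E\<in>\<A>. c constant_on E"
  obtains \<F> where "finite \<F>" "\<F> \<subseteq> \<A>" "\<And>c. c \<in> X \<rightarrow> C \<Longrightarrow> \<exists>E\<in>\<F>. c constant_on E"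
proof -
  define T where "T = product_topology (\<lambda>_. discrete_topology C) X"
  define U where "U E = {c \<in> X \<rightarrow>\<^sub>E C. c constant_on E}" for E
  have topspace_T: "topspace T = (X \<rightarrow>\<^sub>E C)"
    by (simp add: T_def)
  have "compact_space T"
    using \<open>finite C\<close>
    by (simp add: T_def compact_space_product_topology compact_space_discrete_topology)
  moreover have "openin T (U E)" if "E \<in> \<A>" for E
    unfolding T_def U_def using finite_subset[OF that]
    by (intro openin_product_discrete_constant_on) auto
  moreover have "topspace T \<subseteq> \<Union> (U ` \<A>)"
    using constant_on by (force simp: topspace_T U_def)
  ultimately have "\<exists>\<V>. finite \<V> \<and> \<V> \<subseteq> U ` \<A> \<and> topspace T \<subseteq> \<Union>\<V>"
    using \<open>compact_space T\<close>[unfolded compact_space_alt, rule_format, of "U ` \<A>"] by auto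
  then obtain \<F> where "finite \<F>" "\<F> \<subseteq> \<A>" and cover: "topspace T \<subseteq> \<Union> (U ` \<F>)"
    using finite_subset_image by metis
  moreover have "\<exists>E\<in>\<F>. c constant_on E" if "c \<in> X \<rightarrow> C" for c
  proof -
    have "restrict c X \<in> topspace T"
      using that by (auto simp: topspace_T)
    then obtain E where "E \<in> \<F>" "restrict c X constant_on E"
      using cover by (auto simp: U_def)
    moreover have "E \<subseteq> X"
      using \<open>E \<in> \<F>\<close> \<open>\<F> \<subseteq> \<A>\<close> finite_subset by blast
    ultimately show ?thesis
      by (intro bexI[of _ E]) (auto simp: constant_on_def subset_iff)
  qed
  ultimately show ?thesis
    using that by blast
qed

section \<open>Thick sets of natural numbers\<close>

definition thick :: "nat set \<Rightarrow> bool" where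
  "thick T \<longleftrightarrow> (\<forall>n. \<exists>a. {a..<a + n} \<subseteq> T)"

lemma thickE:
  assumes "thick T"
  obtains a where "{a..<a + n} \<subseteq> T"
  using assms unfolding thick_def by blast

lemma not_thick_Diff_iff_bounded_gaps:
  "\<not> thick (T - B) \<longleftrightarrow> (\<exists>L. \<forall>a. {a..<a + L} \<subseteq> T \<longrightarrow> (\<exists>p<L. a + p \<in> B))"
proof -
  have "\<not> {a..<a + n} \<subseteq> T - B \<longleftrightarrow> ({a..<a + n} \<subseteq> T \<longrightarrow> (\<exists>p<n. a + p \<in> B))" for a n
  proof -
    have "(\<exists>p<n. a + p \<in> B) \<longleftrightarrow> (\<exists>x\<in>{a..<a + n}. x \<in> B)"
      by (fastforce simp: le_iff_add)
    then show ?thesis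
      by blast
  qed
  then show ?thesis
    by (simp add: thick_def)
qed

lemma not_thick_Diff_common_gap_bound:
  assumes "finite K" and "\<And>k. k \<in> K \<Longrightarrow> \<not> thick (T - B k)"
  obtains L where "\<And>k a. k \<in> K \<Longrightarrow> {a..<a + L} \<subseteq> T \<Longrightarrow> \<exists>p<L. a + p \<in> B k"
proof -
  have "\<forall>k\<in>K. \<exists>l. \<forall>a. {a..<a + l} \<subseteq> T \<longrightarrow> (\<exists>p<l. a + p \<in> B k)"
    using assms(2) by (simp add: not_thick_Diff_iff_bounded_gaps)
  then obtain l where l: "\<And>k a. k \<in> K \<Longrightarrow> {a..<a + l k} \<subseteq> T \<Longrightarrow> \<exists>p<l k. a + p \<in> B k"
    by metis
  define L where "L = Max (l ` K)"
  have "\<exists>p<L. a + p \<in> B k" if "k \<in> K" "{a..<a + L} \<subseteq> T" for k a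
  proof -
    have "l k \<le> L"
      using that(1) \<open>finite K\<close> by (simp add: L_def)
    then have "{a..<a + l k} \<subseteq> T"
      using that(2) by (auto simp: subset_iff)
    from l[OF that(1) this] show ?thesis
      using \<open>l k \<le> L\<close> by (meson less_le_trans)
  qed
  then show thesis
    by (rule that)
qed

lemma infinite_finite_subset_collision:
  fixes D :: "'a::linorder set"
  assumes "infinite D" and "finite R"
  shows "\<exists>F\<subseteq>D. finite F \<and> (\<forall>f \<in> F \<rightarrow> R. \<exists>m\<in>F. \<exists>n\<in>F. m < n \<and> f m = f n)"
proof -
  obtain F where "F \<subseteq> D" "finite F" and card_F: "card F = Suc (card R)"
    using infinite_arbitrarily_large[OF \<open>infinite D\<close>] by blast
  have "\<exists>m\<in>F. \<exists>n\<in>F. m < n \<and> f m = f n" if "f \<in> F \<rightarrow> R" for f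
  proof -
    have "card (f ` F) \<le> card R"
      using that \<open>finite R\<close> by (intro card_mono) auto
    then have "\<not> inj_on f F"
      using card_F by (intro pigeonhole) simp
    then show ?thesis
      unfolding inj_on_def by (metis linorder_neqE)
  qed
  with \<open>finite F\<close> \<open>F \<subseteq> D\<close> show ?thesis
    by blast
qed

text \<open>Pigeonhole on the offsets from \<open>b + m\<close>, for \<open>m \<in> D\<close>, to the next element of each \<open>B k\<close>,
  where \<open>b\<close> starts a long interval in \<open>T\<close>.\<close>

lemma thick_common_difference:
  assumes "thick T" and "finite K" and "\<And>k. k \<in> K \<Longrightarrow> \<not> thick (T - B k)" and "infinite D"
  obtains m n where "m \<in> D" "n \<in> D" "m < n" "\<And>k. k \<in> K \<Longrightarrow> \<exists>x\<in>B k. x + (n - m) \<in> B k"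
proof -
  obtain L where gap: "\<And>k a. k \<in> K \<Longrightarrow> {a..<a + L} \<subseteq> T \<Longrightarrow> \<exists>p<L. a + p \<in> B k"
    using not_thick_Diff_common_gap_bound[of K T B] assms(2,3) by blast
  have "finite (K \<rightarrow>\<^sub>E {..<L})"
    using \<open>finite K\<close> by (simp add: finite_PiE)
  from infinite_finite_subset_collision[OF \<open>infinite D\<close> this]
  obtain F where "finite F" "F \<subseteq> D" and collision:
      "\<forall>\<phi> \<in> F \<rightarrow> (K \<rightarrow>\<^sub>E {..<L}). \<exists>m\<in>F. \<exists>n\<in>F. m < n \<and> \<phi> m = \<phi> n"
    by auto
  obtain b where b: "{b..<b + (Max F + L)} \<subseteq> T"
    using \<open>thick T\<close> by (rule thickE)
  have "\<exists>\<phi> \<in> K \<rightarrow>\<^sub>E {..<L}. \<forall>k\<in>K. b + m + \<phi> k \<in> B k" if "m \<in> F" for m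
  proof -
    have "m \<le> Max F"
      using \<open>finite F\<close> that by simp
    then have "{b + m..<b + m + L} \<subseteq> T"
      using b by (auto simp: subset_iff)
    then have "\<forall>k\<in>K. \<exists>p. p < L \<and> b + m + p \<in> B k"
      using gap by blast
    then obtain \<phi> where "\<And>k. k \<in> K \<Longrightarrow> \<phi> k < L \<and> b + m + \<phi> k \<in> B k"
      by metis
    then show ?thesis
      by (intro bexI[of _ "restrict \<phi> K"]) auto
  qed
  then obtain \<phi> where offset: "\<And>m. m \<in> F \<Longrightarrow> \<phi> m \<in> K \<rightarrow>\<^sub>E {..<L}"
    and hit: "\<And>m k. m \<in> F \<Longrightarrow> k \<in> K \<Longrightarrow> b + m + \<phi> m k \<in> B k"
    by metis
  then obtain m n where "m \<in> F" "n \<in> F" "m < n" "\<phi> m = \<phi> n"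
    using bspec[OF collision, of \<phi>] by blast
  have "\<exists>x\<in>B k. x + (n - m) \<in> B k" if "k \<in> K" for k
  proof -
    have "b + m + \<phi> m k + (n - m) = b + n + \<phi> n k"
      using \<open>m < n\<close> \<open>\<phi> m = \<phi> n\<close> by simp
    then show ?thesis
      using hit[OF \<open>m \<in> F\<close> that] hit[OF \<open>n \<in> F\<close> that] by metis
  qed
  with \<open>m \<in> F\<close> \<open>n \<in> F\<close> \<open>F \<subseteq> D\<close> \<open>m < n\<close> show thesis
    by (intro that[of m n]) auto
qed

lemma thick_contains_long_dilated_interval:
  assumes "thick T" and "d > 0"
  shows "\<exists>a>0. \<forall>t\<in>{a..a + m}. d * t \<in> T"
proof -
  obtain b where b: "{b..<b + d * (m + 2)} \<subseteq> T"
    using \<open>thick T\<close> by (rule thickE)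
  define a where "a = b div d + 1"
  have a: "b < d * a" "d * a \<le> b + d"
    using \<open>d > 0\<close> by (auto simp: a_def algebra_simps dividend_less_times_div)
  have "d * t \<in> T" if "t \<in> {a..a + m}" for t
  proof -
    have "d * a \<le> d * t" "d * t \<le> d * a + d * m"
      using that by (auto simp flip: distrib_left)
    moreover have "b + d * (m + 2) = b + d + d * m + d"
      by (simp add: algebra_simps)
    ultimately have "d * t \<in> {b..<b + d * (m + 2)}"
      using a \<open>d > 0\<close> unfolding atLeastLessThan_iff by linarith
    with b show ?thesis ..
  qed
  then show ?thesis
    by (intro exI[of _ a]) (auto simp: a_def)
qed

lemma thick_contains_dilated_differences:
  assumes "thick T" and "d > 0"
  obtains D where "infinite D" "\<And>m n. m \<in> D \<Longrightarrow> n \<in> D \<Longrightarrow> m < n \<Longrightarrow> d * (n - m) \<in> T"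
proof -
  have "\<forall>m. \<exists>a>0. \<forall>t\<in>{a..a + m}. d * t \<in> T"
    using thick_contains_long_dilated_interval[OF assms] by blast
  then obtain a where a_pos: "\<And>m. a m > 0"
    and a: "\<And>m t. t \<in> {a m..a m + m} \<Longrightarrow> d * t \<in> T"
    by metis
  define s where "s = rec_nat 0 (\<lambda>_ m. m + a m)"
  have s_Suc: "s (Suc i) = s i + a (s i)" for i
    by (simp add: s_def)
  have "strict_mono s"
    using a_pos by (simp add: strict_mono_Suc_iff s_Suc)
  have "d * (s j - s i) \<in> T" if "s i < s j" for i j
  proof -
    from that have "i < j"
      using \<open>strict_mono s\<close> by (simp add: strict_mono_less)
    then obtain j' where "j = Suc j'" "i \<le> j'"
      by (cases j) auto
    moreover from this have "s i \<le> s j'"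
      using \<open>strict_mono s\<close> by (simp add: strict_mono_less_eq)
    ultimately have "s j - s i \<in> {a (s j')..a (s j') + s j'}"
      by (simp add: s_Suc) linarith
    then show ?thesis
      by (rule a)
  qed
  moreover have "infinite (range s)"
    using \<open>strict_mono s\<close> by (simp add: finite_image_iff strict_mono_imp_inj_on)
  ultimately show thesis
    by (intro that[of "range s"]) auto
qed

text \<open>If removing some colour class leaves a thick set, use fewer colours. Otherwise each class
  has bounded gaps in \<open>T\<close>, and some \<open>t\<close> with \<open>d * t \<in> T\<close> is a difference of every
  class at once, in particular of the class of \<open>d * t\<close>.\<close>

lemma thick_monochromatic_dilated_difference:
  assumes "finite (c ` T)" and "thick T" and "d > 0"
  shows "\<exists>x\<in>T. \<exists>t>0. x + t \<in> T \<and> d * t \<in> T \<and> c (x + t) = c x \<and> c (d * t) = c x"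
  using assms(1,2)
proof (induction "c ` T" arbitrary: T rule: finite_psubset_induct)
  case psubset
  define B where "B k = {x \<in> T. c x = k}" for k
  show ?case
  proof (cases "\<exists>k\<in>c ` T. thick (T - B k)")
    case True
    then obtain k where "k \<in> c ` T" "thick (T - B k)" ..
    have "k \<notin> c ` (T - B k)"
      by (auto simp: B_def)
    with \<open>k \<in> c ` T\<close> have "c ` (T - B k) \<subset> c ` T"
      by blast
    from psubset.hyps(2)[OF this \<open>thick (T - B k)\<close>] show ?thesis
      by (metis DiffD1)
  next
    case False
    then have not_thick: "\<not> thick (T - B k)" if "k \<in> c ` T" for k
      using that by blast
    obtain D where "infinite D"
      and dilated: "\<And>m n. m \<in> D \<Longrightarrow> n \<in> D \<Longrightarrow> m < n \<Longrightarrow> d * (n - m) \<in> T"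
      using thick_contains_dilated_differences[OF \<open>thick T\<close> \<open>d > 0\<close>] by blast
    obtain m n where "m \<in> D" "n \<in> D" "m < n"
      and difference: "\<And>k. k \<in> c ` T \<Longrightarrow> \<exists>x\<in>B k. x + (n - m) \<in> B k"
      using thick_common_difference[of T "c ` T" B D]
        \<open>thick T\<close> psubset.hyps(1) not_thick \<open>infinite D\<close> by blast
    moreover have "d * (n - m) \<in> T"
      using dilated \<open>m \<in> D\<close> \<open>n \<in> D\<close> \<open>m < n\<close> .
    moreover from this obtain x where
      "x \<in> B (c (d * (n - m)))" "x + (n - m) \<in> B (c (d * (n - m)))"
      using difference by blast
    ultimately show ?thesis
      by (intro bexI[of _ x] exI[of _ "n - m"]) (auto simp: B_def)
  qed
qed

text \<open>Recording the values of all colourings at once reduces to a single colouring.\<close>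

lemma simultaneous_monochromatic_dilated_difference:
  fixes c :: "'a \<Rightarrow> nat \<Rightarrow> 'b"
  assumes "finite F" and "\<And>f. f \<in> F \<Longrightarrow> finite (c f ` {0<..})" and "d > 0"
  shows "\<exists>x>0. \<exists>t>0. \<forall>f\<in>F. c f (x + t) = c f x \<and> c f (d * t) = c f x"
proof -
  define profile where "profile n = (\<lambda>f\<in>F. c f n)" for n
  have "profile ` {0<..} \<subseteq> (\<Pi>\<^sub>E f\<in>F. c f ` {0<..})"
    by (auto simp: profile_def)
  then have "finite (profile ` {0<..})"
    by (rule finite_subset) (simp add: finite_PiE assms(1,2))
  moreover have "thick {0<..}"
    unfolding thick_def by (intro allI exI[of _ 1]) auto
  ultimately obtain x t where "x > 0" "t > 0"
    and same: "profile (x + t) = profile x" "profile (d * t) = profile x"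
    using thick_monochromatic_dilated_difference[of profile "{0<..}" d] \<open>d > 0\<close> by fastforce
  have "c f (x + t) = c f x \<and> c f (d * t) = c f x" if "f \<in> F" for f
    using same[THEN fun_cong, of f] that by (simp add: profile_def)
  with \<open>x > 0\<close> \<open>t > 0\<close> show ?thesis
    by blast
qed

section \<open>Column spaces as kernels\<close>

text \<open>A zero row \<open>l\<close> has pivot \<open>f l = n\<close>, so column \<open>l\<close> of the matrix selecting the pivots
  vanishes.\<close>

lemma pivot_fun_mult_pivot_selection:
  fixes C :: "'a::semiring_1 mat"
  assumes C: "C \<in> carrier_mat m n" and "pivot_fun C f n"
  shows "C * mat n m (\<lambda>(k, i). of_bool (k = f i)) = mat m m (\<lambda>(i, l). of_bool (i = l \<and> f l < n))"
    (is "C * ?G = ?E")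
proof (rule eq_matI)
  note pivot = pivot_funD[OF carrier_matD(1)[OF C] \<open>pivot_fun C f n\<close>]
  fix i l assume "i < dim_row ?E" "l < dim_col ?E"
  then have "i < m" "l < m"
    by auto
  then have "(C * ?G) $$ (i, l) = (\<Sum>k<n. C $$ (i, k) * of_bool (k = f l))"
    using C by (simp add: scalar_prod_def atLeast0LessThan)
  also have "\<dots> = (if f l < n then C $$ (i, f l) else 0)"
    by (simp add: of_bool_def if_distrib cong: if_cong)
  also have "\<dots> = ?E $$ (i, l)"
    using pivot(4,5) \<open>i < m\<close> \<open>l < m\<close> by auto
  finally show "(C * ?G) $$ (i, l) = ?E $$ (i, l)" .
qed (use C in auto)

lemma row_echelon_form_generalised_inverse:
  fixes C :: "'a::semiring_1 mat"
  assumes C: "C \<in> carrier_mat m n" and "row_echelon_form C"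
  obtains G where "G \<in> carrier_mat n m" "C * G * C = C"
proof -
  obtain f where f: "pivot_fun C f n"
    using assms unfolding row_echelon_form_def by auto
  note pivot = pivot_funD[OF carrier_matD(1)[OF C] f]
  define G :: "'a mat" where "G = mat n m (\<lambda>(k, i). of_bool (k = f i))"
  have G: "G \<in> carrier_mat n m"
    by (simp add: G_def)
  have "C * G * C = C"
  proof (rule eq_matI)
    fix i k assume "i < dim_row C" "k < dim_col C"
    then have "i < m" "k < n"
      using C by auto
    then have "(C * G * C) $$ (i, k) = (\<Sum>l<m. of_bool (i = l \<and> f l < n) * C $$ (l, k))"
      unfolding G_def pivot_fun_mult_pivot_selection[OF C f]
      using C by (simp add: scalar_prod_def atLeast0LessThan)
    also have "\<dots> = (\<Sum>l<m. if l = i then of_bool (f i < n) * C $$ (i, k) else 0)"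
      by (intro sum.cong) auto
    also have "\<dots> = of_bool (f i < n) * C $$ (i, k)"
      using \<open>i < m\<close> by simp
    also have "\<dots> = C $$ (i, k)"
      using pivot(1,2) \<open>i < m\<close> \<open>k < n\<close> by (cases "f i < n") force+
    finally show "(C * G * C) $$ (i, k) = C $$ (i, k)" .
  qed (use C G in auto)
  with G show thesis
    by (rule that)
qed

lemma generalised_inverse_exists:
  fixes A :: "'a::field mat"
  assumes A: "A \<in> carrier_mat m n"
  obtains B where "B \<in> carrier_mat n m" "A * B * A = A"
proof -
  obtain C Z where gauss_jordan: "gauss_jordan A (0\<^sub>m m 0) = (C, Z)"
    by fastforce
  then have "row_echelon_form C"
    by (rule gauss_jordan_row_echelon[OF A])
  have C: "C \<in> carrier_mat m n"
    using gauss_jordan_carrier(1)[OF A zero_carrier_mat gauss_jordan] .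
  obtain G where G: "G \<in> carrier_mat n m" and CGC: "C * G * C = C"
    using row_echelon_form_generalised_inverse[OF C \<open>row_echelon_form C\<close>] .
  obtain P where "P \<in> Units (ring_mat TYPE('a) m ())" and C_eq: "C = P * A"
    using gauss_jordan_transform[OF A zero_carrier_mat gauss_jordan, of "()"] by blast
  then obtain R where P: "P \<in> carrier_mat m m" and R: "R \<in> carrier_mat m m" and "R * P = 1\<^sub>m m"
    by (auto simp: Units_def ring_mat_def)
  have A_eq: "A = R * C"
    using \<open>R * P = 1\<^sub>m m\<close> A P R by (simp add: C_eq flip: assoc_mult_mat)
  have "A * (G * P) * A = A * G * P * A"
    by (simp only: assoc_mult_mat[OF A G P])
  also have "\<dots> = A * G * (P * A)"
    by (rule assoc_mult_mat[OF mult_carrier_mat[OF A G] P A])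
  also have "\<dots> = R * C * G * C"
    by (simp only: C_eq[symmetric] A_eq[symmetric])
  also have "\<dots> = R * (C * G * C)"
    by (simp only: assoc_mult_mat[OF R C G] assoc_mult_mat[OF R mult_carrier_mat[OF C G] C])
  also have "\<dots> = A"
    by (simp add: CGC A_eq)
  finally show thesis
    using that[of "G * P"] G P by simp
qed

lemma generalised_inverse_fixed_iff_kernel:
  fixes A :: "'a::comm_ring_1 mat"
  assumes A: "A \<in> carrier_mat m n" and B: "B \<in> carrier_mat n m" and a: "a \<in> carrier_vec m"
  shows "(1\<^sub>m m - A * B) *\<^sub>v a = 0\<^sub>v m \<longleftrightarrow> A *\<^sub>v (B *\<^sub>v a) = a"
proof -
  have "(1\<^sub>m m - A * B) *\<^sub>v a = a - A *\<^sub>v (B *\<^sub>v a)"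
    using A B a by (simp add: minus_mult_distrib_mat_vec[of _ m m] assoc_mult_mat_vec[of _ m n])
  moreover have "x - y = 0\<^sub>v m \<longleftrightarrow> y = x"
    if "x \<in> carrier_vec m" "y \<in> carrier_vec m" for x y :: "'a vec"
    using that by (auto simp: vec_eq_iff)
  ultimately show ?thesis
    using A B a by simp
qed

lemma mult_mat_vec_eq_zero_if_other_rows:
  fixes N :: "'a::idom mat"
  assumes N: "N \<in> carrier_mat m n" and w: "w \<in> carrier_vec m" and x: "x \<in> carrier_vec n"
    and dependent: "transpose_mat N *\<^sub>v w = 0\<^sub>v n"
    and k: "k < m" "w $ k \<noteq> 0"
    and other_rows: "\<And>i. i < m \<Longrightarrow> i \<noteq> k \<Longrightarrow> (N *\<^sub>v x) $ i = 0"
  shows "N *\<^sub>v x = 0\<^sub>v m"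
proof -
  have "w $ k * (N *\<^sub>v x) $ k = w \<bullet> (N *\<^sub>v x)"
    using N k other_rows
    by (simp add: scalar_prod_def sum.remove[of _ k] del: index_mult_mat_vec)
  also have "\<dots> = (transpose_mat N *\<^sub>v w) \<bullet> x"
    using N w x by (simp add: transpose_vec_mult_scalar)
  also have "\<dots> = 0"
    using x by (simp add: dependent)
  finally have "(N *\<^sub>v x) $ k = 0"
    using k by simp
  with other_rows have "(N *\<^sub>v x) $ i = 0" if "i < m" for i
    using that by (cases "i = k") auto
  then show ?thesis
    using N by (intro eq_vecI) auto
qed

lemma delete_dependent_row:
  fixes N :: "'a::idom mat"
  assumes N: "N \<in> carrier_mat m n" and w: "w \<in> carrier_vec m" "w \<noteq> 0\<^sub>v m"
    and dependent: "transpose_mat N *\<^sub>v w = 0\<^sub>v n"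
  obtains N' where "N' \<in> carrier_mat (m - 1) n"
    "\<And>x. x \<in> carrier_vec n \<Longrightarrow> N' *\<^sub>v x = 0\<^sub>v (m - 1) \<longleftrightarrow> N *\<^sub>v x = 0\<^sub>v m"
proof -
  obtain k where k: "k < m" "w $ k \<noteq> 0"
    using w by (auto simp: vec_eq_iff)
  define N' where "N' = mat (m - 1) n (\<lambda>(r, l). N $$ (insert_index k r, l))"
  have N': "N' \<in> carrier_mat (m - 1) n"
    by (simp add: N'_def)
  have N'_index: "(N' *\<^sub>v x) $ r = (N *\<^sub>v x) $ insert_index k r"
    if "r < m - 1" "x \<in> carrier_vec n" for r x
    using that N by (auto simp: N'_def insert_index_def scalar_prod_def)
  show thesis
  proof (intro that[OF N'] iffI)
    fix x :: "'a vec" assume x: "x \<in> carrier_vec n" and "N *\<^sub>v x = 0\<^sub>v m"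
    then show "N' *\<^sub>v x = 0\<^sub>v (m - 1)"
      using N' by (intro eq_vecI)
        (auto simp: N'_index insert_index_def simp del: index_mult_mat_vec)
  next
    fix x :: "'a vec" assume x: "x \<in> carrier_vec n" and N'x: "N' *\<^sub>v x = 0\<^sub>v (m - 1)"
    have "(N *\<^sub>v x) $ i = 0" if "i < m" "i \<noteq> k" for i
    proof -
      have "delete_index k i < m - 1"
        using that k by (auto simp: delete_index_def)
      from N'_index[OF this x] N'x this show ?thesis
        using that by (simp add: insert_delete_index)
    qed
    then show "N *\<^sub>v x = 0\<^sub>v m"
      by (rule mult_mat_vec_eq_zero_if_other_rows[OF N w(1) x dependent k])
  qed
qed

lemma idempotent_row_annihilates_complement:
  fixes Q :: "'a::comm_ring_1 mat"
  assumes Q: "Q \<in> carrier_mat m m" and "Q * Q = Q" and "i < m"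
  shows "transpose_mat (1\<^sub>m m - Q) *\<^sub>v row Q i = 0\<^sub>v m"
proof -
  have "transpose_mat (1\<^sub>m m - Q) *\<^sub>v row Q i = row (Q * (1\<^sub>m m - Q)) i"
    using Q \<open>i < m\<close>
    by (intro eq_vecI) (auto intro!: comm_scalar_prod[OF carrier_vecI carrier_vecI])
  also have "Q * (1\<^sub>m m - Q) = 0\<^sub>m m m"
    using Q \<open>Q * Q = Q\<close> by (simp add: mult_minus_distrib_mat[of Q m m "1\<^sub>m m" m Q])
  finally show ?thesis
    using \<open>i < m\<close> by simp
qed

lemma column_space_as_kernel:
  fixes A :: "'a::field mat"
  assumes A: "A \<in> carrier_mat m n" and "A \<noteq> 0\<^sub>m m n"
  obtains B N where "B \<in> carrier_mat n m" "N \<in> carrier_mat (m - 1) m"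
    "\<And>y. y \<in> carrier_vec n \<Longrightarrow> N *\<^sub>v (A *\<^sub>v y) = 0\<^sub>v (m - 1)"
    "\<And>a. a \<in> carrier_vec m \<Longrightarrow> N *\<^sub>v a = 0\<^sub>v (m - 1) \<Longrightarrow> A *\<^sub>v (B *\<^sub>v a) = a"
proof -
  obtain B where B: "B \<in> carrier_mat n m" and ABA: "A * B * A = A"
    using generalised_inverse_exists[OF A] .
  define Q where "Q = A * B"
  have Q: "Q \<in> carrier_mat m m"
    using A B by (simp add: Q_def)
  have "Q \<noteq> 0\<^sub>m m m"
    using ABA A \<open>A \<noteq> 0\<^sub>m m n\<close> by (auto simp: Q_def)
  then obtain i where "i < m" and row_nonzero: "row Q i \<noteq> 0\<^sub>v m"
    using Q by (metis carrier_matD eq_matI index_row(1) index_zero_mat index_zero_vec(1))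
  have "Q * Q = Q * A * B"
    using assoc_mult_mat[OF Q A B] by (simp only: Q_def)
  then have "Q * Q = Q"
    by (simp only: Q_def ABA)
  have "1\<^sub>m m - Q \<in> carrier_mat m m" "row Q i \<in> carrier_vec m"
    using Q \<open>i < m\<close> by auto
  then obtain N where N: "N \<in> carrier_mat (m - 1) m" and kernel:
      "\<And>a. a \<in> carrier_vec m \<Longrightarrow> N *\<^sub>v a = 0\<^sub>v (m - 1) \<longleftrightarrow> (1\<^sub>m m - Q) *\<^sub>v a = 0\<^sub>v m"
    using delete_dependent_row row_nonzero
      idempotent_row_annihilates_complement[OF Q \<open>Q * Q = Q\<close> \<open>i < m\<close>] by blast
  have kernel_iff: "N *\<^sub>v a = 0\<^sub>v (m - 1) \<longleftrightarrow> A *\<^sub>v (B *\<^sub>v a) = a" if "a \<in> carrier_vec m" for a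
    using kernel[OF that] generalised_inverse_fixed_iff_kernel[OF A B that] by (simp add: Q_def)
  show thesis
  proof (rule that[OF B N])
    fix y :: "'a vec" assume y: "y \<in> carrier_vec n"
    then have Ay: "A *\<^sub>v y \<in> carrier_vec m"
      using A by simp
    have "A *\<^sub>v (B *\<^sub>v (A *\<^sub>v y)) = A * B * A *\<^sub>v y"
      by (simp only: assoc_mult_mat_vec[OF A B Ay]
          assoc_mult_mat_vec[OF mult_carrier_mat[OF A B] A y])
    then show "N *\<^sub>v (A *\<^sub>v y) = 0\<^sub>v (m - 1)"
      by (simp only: kernel_iff[OF Ay] ABA)
  qed (use kernel_iff in blast)
qed

section \<open>The difference extension of a matrix\<close>

definition append_cols :: "'a::zero mat \<Rightarrow> 'a mat \<Rightarrow> 'a mat"  (infixr \<open>@\<^sub>c\<close> 65) where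
  "A @\<^sub>c B = four_block_mat A B (0\<^sub>m 0 (dim_col A)) (0\<^sub>m 0 (dim_col B))"

lemma append_cols_carrier:
  assumes "A \<in> carrier_mat m n\<^sub>1" and "B \<in> carrier_mat m n\<^sub>2"
  shows "A @\<^sub>c B \<in> carrier_mat m (n\<^sub>1 + n\<^sub>2)"
  using assms by (auto simp: append_cols_def)

lemma append_cols_mult_vec:
  fixes A B :: "'a::semiring_0 mat"
  assumes A: "A \<in> carrier_mat m n\<^sub>1" and B: "B \<in> carrier_mat m n\<^sub>2"
    and a: "a \<in> carrier_vec n\<^sub>1" and b: "b \<in> carrier_vec n\<^sub>2"
  shows "(A @\<^sub>c B) *\<^sub>v (a @\<^sub>v b) = A *\<^sub>v a + B *\<^sub>v b"
proof -
  have "(A @\<^sub>c B) *\<^sub>v (a @\<^sub>v b) =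
      (A *\<^sub>v a + B *\<^sub>v b) @\<^sub>v (0\<^sub>m 0 n\<^sub>1 *\<^sub>v a + 0\<^sub>m 0 n\<^sub>2 *\<^sub>v b)"
    unfolding append_cols_def carrier_matD(2)[OF A] carrier_matD(2)[OF B]
    by (rule four_block_mat_mult_vec[OF A B _ _ a b]) auto
  also have "\<dots> = A *\<^sub>v a + B *\<^sub>v b"
    using A B by (intro eq_vecI) auto
  finally show ?thesis .
qed

definition difference_extension :: "'a::comm_ring_1 \<Rightarrow> 'a mat \<Rightarrow> 'a mat" where
  "difference_extension d N = (let u = dim_col N in
     (N @\<^sub>c 0\<^sub>m (dim_row N) (u + u)) @\<^sub>r (1\<^sub>m u @\<^sub>c (- d) \<cdot>\<^sub>m 1\<^sub>m u @\<^sub>c d \<cdot>\<^sub>m 1\<^sub>m u))"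

lemma difference_extension_carrier:
  assumes "N \<in> carrier_mat j u"
  shows "difference_extension d N \<in> carrier_mat (j + u) (3 * u)"
proof -
  have "difference_extension d N \<in> carrier_mat (j + u) (u + (u + u))"
    using assms unfolding difference_extension_def Let_def
    by (intro carrier_append_rows append_cols_carrier) auto
  then show ?thesis
    by (simp add: numeral_3_eq_3)
qed

lemma difference_extension_mult_vec:
  assumes N: "N \<in> carrier_mat j u"
    and a: "a \<in> carrier_vec u" and b: "b \<in> carrier_vec u" and c: "c \<in> carrier_vec u"
  shows "difference_extension d N *\<^sub>v (a @\<^sub>v b @\<^sub>v c) = N *\<^sub>v a @\<^sub>v (a - d \<cdot>\<^sub>v (b - c))"
proof -
  define I :: "'a mat" where "I = 1\<^sub>m u"
  have I: "I \<in> carrier_mat u u" "- d \<cdot>\<^sub>m I \<in> carrier_mat u u" "d \<cdot>\<^sub>m I \<in> carrier_mat u u"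
    by (auto simp: I_def)
  have bc: "b @\<^sub>v c \<in> carrier_vec (u + u)"
    using b c by simp
  define Z :: "'a mat" where "Z = 0\<^sub>m j (u + u)"
  have Z: "Z \<in> carrier_mat j (u + u)"
    by (simp add: Z_def)
  have "difference_extension d N = (N @\<^sub>c Z) @\<^sub>r (I @\<^sub>c (- d \<cdot>\<^sub>m I) @\<^sub>c (d \<cdot>\<^sub>m I))"
    using N by (simp add: difference_extension_def Let_def I_def Z_def)
  also have "\<dots> *\<^sub>v (a @\<^sub>v b @\<^sub>v c) =
      (N @\<^sub>c Z) *\<^sub>v (a @\<^sub>v b @\<^sub>v c) @\<^sub>v (I @\<^sub>c (- d \<cdot>\<^sub>m I) @\<^sub>c (d \<cdot>\<^sub>m I)) *\<^sub>v (a @\<^sub>v b @\<^sub>v c)"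
    using a b c
    by (intro mat_mult_append[OF append_cols_carrier[OF N Z]
          append_cols_carrier[OF I(1) append_cols_carrier[OF I(2,3)]]]) simp
  also have "(N @\<^sub>c Z) *\<^sub>v (a @\<^sub>v b @\<^sub>v c) = N *\<^sub>v a"
    using N a bc by (subst append_cols_mult_vec[OF N Z a bc]) (auto simp: Z_def intro!: eq_vecI)
  also have "(I @\<^sub>c (- d \<cdot>\<^sub>m I) @\<^sub>c (d \<cdot>\<^sub>m I)) *\<^sub>v (a @\<^sub>v b @\<^sub>v c)
      = I *\<^sub>v a + (- d \<cdot>\<^sub>m I *\<^sub>v b + d \<cdot>\<^sub>m I *\<^sub>v c)"
    using append_cols_mult_vec[OF I(1) append_cols_carrier[OF I(2,3)] a bc]
    by (simp add: append_cols_mult_vec[OF I(2,3) b c])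
  also have "\<dots> = a - d \<cdot>\<^sub>v (b - c)"
    using a b c by (intro eq_vecI) (auto simp: I_def algebra_simps)
  finally show ?thesis .
qed

lemma difference_extension_kernel_iff:
  assumes N: "N \<in> carrier_mat j u"
    and a: "a \<in> carrier_vec u" and b: "b \<in> carrier_vec u" and c: "c \<in> carrier_vec u"
  shows "difference_extension d N *\<^sub>v (a @\<^sub>v b @\<^sub>v c) = 0\<^sub>v (j + u) \<longleftrightarrow>
    N *\<^sub>v a = 0\<^sub>v j \<and> a = d \<cdot>\<^sub>v (b - c)"
proof -
  have "0\<^sub>v (j + u) = 0\<^sub>v j @\<^sub>v (0\<^sub>v u :: 'a vec)"
    by auto
  moreover have "a - d \<cdot>\<^sub>v (b - c) = 0\<^sub>v u \<longleftrightarrow> a = d \<cdot>\<^sub>v (b - c)"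
    using a b c by (auto simp: vec_eq_iff)
  ultimately show ?thesis
    using N a by (simp add: difference_extension_mult_vec[OF assms] append_vec_eq[of _ j])
qed

lemma difference_extension_kernel_multiples:
  fixes a :: "'a::field vec"
  assumes N: "N \<in> carrier_mat j u" and a: "a \<in> carrier_vec u" and "N *\<^sub>v a = 0\<^sub>v j"
  shows "difference_extension d N *\<^sub>v ((d * t) \<cdot>\<^sub>v a @\<^sub>v (x + t) \<cdot>\<^sub>v a @\<^sub>v x \<cdot>\<^sub>v a) = 0\<^sub>v (j + u)"
proof -
  have "N *\<^sub>v ((d * t) \<cdot>\<^sub>v a) = 0\<^sub>v j"
    using \<open>N *\<^sub>v a = 0\<^sub>v j\<close> by (auto simp: mult_mat_vec[OF N a])
  moreover have "(d * t) \<cdot>\<^sub>v a = d \<cdot>\<^sub>v ((x + t) \<cdot>\<^sub>v a - x \<cdot>\<^sub>v a)"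
    by (auto simp: algebra_simps)
  ultimately show ?thesis
    using a by (simp add: difference_extension_kernel_iff[OF N])
qed

section \<open>Integral multiples and vectors over additive subgroups\<close>

lemma common_denominator:
  fixes X :: "'a::field_char_0 set"
  assumes "finite X" and "X \<subseteq> \<rat>"
  obtains d :: nat where "d > 0" "\<And>x. x \<in> X \<Longrightarrow> of_nat d * x \<in> \<int>"
proof -
  have "\<exists>n::nat. n > 0 \<and> of_nat n * x \<in> \<int>" if "x \<in> X" for x
  proof -
    from that \<open>X \<subseteq> \<rat>\<close> obtain p q :: int where "q > 0" "x = of_int p / of_int q"
      by (blast elim: Rats_cases')
    then have "of_nat (nat q) * x = of_int p"
      by simp
    with \<open>q > 0\<close> show ?thesis
      by (intro exI[of _ "nat q"]) simp
  qed
  then obtain n :: "'a \<Rightarrow> nat" where n: "\<And>x. x \<in> X \<Longrightarrow> n x > 0"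
    "\<And>x. x \<in> X \<Longrightarrow> of_nat (n x) * x \<in> \<int>"
    by metis
  show thesis
  proof (rule that[of "prod n X"])
    fix x assume "x \<in> X"
    then have "of_nat (prod n X) * x = of_nat (prod n (X - {x})) * (of_nat (n x) * x)"
      using \<open>finite X\<close> by (simp add: prod.remove[of X x n] mult_ac)
    also have "\<dots> \<in> \<int>"
      by (rule Ints_mult[OF Ints_of_nat n(2)[OF \<open>x \<in> X\<close>]])
    finally show "of_nat (prod n X) * x \<in> \<int>" .
  qed (use n(1) in \<open>simp add: prod_pos\<close>)
qed

lemma integral_multiple_exists:
  fixes B :: "rat mat"
  obtains d :: nat where "d > 0" "elements_mat (of_nat d \<cdot>\<^sub>m B) \<subseteq> \<int>"
proof -
  have "elements_mat B \<subseteq> \<rat>"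
    by (simp add: Rats_def)
  then obtain d where "d > 0" and d: "\<And>x. x \<in> elements_mat B \<Longrightarrow> of_nat d * x \<in> \<int>"
    using common_denominator[of "elements_mat B"] by (auto simp: elements_mat_def)
  have "elements_mat (of_nat d \<cdot>\<^sub>m B) \<subseteq> \<int>"
    using d by fastforce
  with \<open>d > 0\<close> show thesis
    by (rule that)
qed

lemma vecs_over_iff: "x \<in> vecs_over T n \<longleftrightarrow> x \<in> carrier_vec n \<and> (\<forall>i<n. x $ i \<in> T)"
  by (auto simp: vecs_over_def vec_set_def)

lemma vec_set_append: "set\<^sub>v (a @\<^sub>v b) = set\<^sub>v a \<union> set\<^sub>v b"
  by (simp flip: set_list_of_vec)

lemma vecs_over_append:
  assumes "a \<in> vecs_over T m" and "b \<in> vecs_over T n"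
  shows "a @\<^sub>v b \<in> vecs_over T (m + n)"
  using assms by (auto simp: vecs_over_def vec_set_append)

lemma vecs_over_append_cases:
  assumes "s \<in> vecs_over T (m + n)"
  obtains a b where "s = a @\<^sub>v b" "a \<in> vecs_over T m" "b \<in> vecs_over T n"
proof
  show "s = vec_first s m @\<^sub>v vec_last s n"
    using assms by (simp add: vecs_over_def)
  have "set\<^sub>v (vec_first s m) \<union> set\<^sub>v (vec_last s n) \<subseteq> T"
    using assms by (simp add: vecs_over_def flip: vec_set_append)
  then show "vec_first s m \<in> vecs_over T m" "vec_last s n \<in> vecs_over T n"
    by (simp_all add: vecs_over_def)
qed

context
  fixes S :: "'a::ring_1 set"
  assumes S: "additive_subgroup S (class_ring :: 'a ring)"
begin

lemma additive_subgroup_class_ring_zero: "0 \<in> S"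
  using additive_subgroup.zero_closed[OF S] by simp

lemma additive_subgroup_class_ring_add: "x \<in> S \<Longrightarrow> y \<in> S \<Longrightarrow> x + y \<in> S"
  using additive_subgroup.a_closed[OF S] by simp

lemma additive_subgroup_class_ring_uminus: "x \<in> S \<Longrightarrow> - x \<in> S"
  using additive_subgroup.a_inv_closed[OF S] by (simp add: class_ring_simps)

lemma additive_subgroup_class_ring_diff: "x \<in> S \<Longrightarrow> y \<in> S \<Longrightarrow> x - y \<in> S"
  using additive_subgroup_class_ring_add[OF _ additive_subgroup_class_ring_uminus] by fastforce

lemma additive_subgroup_class_ring_of_nat_mult: "x \<in> S \<Longrightarrow> of_nat n * x \<in> S"
  by (induction n)
    (auto simp: distrib_right
      intro: additive_subgroup_class_ring_zero additive_subgroup_class_ring_add)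

lemma additive_subgroup_class_ring_Ints_mult:
  assumes "k \<in> \<int>" and "x \<in> S"
  shows "k * x \<in> S"
proof -
  obtain n where "k = of_nat n \<or> k = - of_nat n"
    using \<open>k \<in> \<int>\<close> by (metis Ints_cases int_cases2 of_int_minus of_int_of_nat_eq)
  then show ?thesis
    using additive_subgroup_class_ring_of_nat_mult[OF \<open>x \<in> S\<close>, of n]
      additive_subgroup_class_ring_uminus by auto
qed

lemma additive_subgroup_class_ring_sum:
  "(\<And>i. i \<in> I \<Longrightarrow> f i \<in> S) \<Longrightarrow> (\<Sum>i\<in>I. f i) \<in> S"
  by (induction I rule: infinite_finite_induct)
    (auto intro: additive_subgroup_class_ring_zero additive_subgroup_class_ring_add)

end

lemma vecs_over_diff:
  assumes S: "additive_subgroup S (class_ring :: rat ring)"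
    and "x \<in> vecs_over S n" and "y \<in> vecs_over S n"
  shows "x - y \<in> vecs_over S n"
  using assms(2,3) by (auto simp: vecs_over_iff additive_subgroup_class_ring_diff[OF S])

lemma vecs_over_int_mat_mult:
  assumes S: "additive_subgroup S (class_ring :: rat ring)"
    and M: "M \<in> carrier_mat m n" "elements_mat M \<subseteq> \<int>" and x: "x \<in> vecs_over S n"
  shows "M *\<^sub>v x \<in> vecs_over S m"
proof -
  have "dim_vec x = n"
    using x by (auto simp: vecs_over_iff)
  have "(M *\<^sub>v x) $ i \<in> S" if "i < m" for i
  proof -
    have "M $$ (i, k) * x $ k \<in> S" if "k < n" for k
    proof (rule additive_subgroup_class_ring_Ints_mult[OF S])
      show "M $$ (i, k) \<in> \<int>"
        using M \<open>i < m\<close> that by blast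
      show "x $ k \<in> S"
        using x that by (simp add: vecs_over_iff)
    qed
    then have "(\<Sum>k = 0..<n. M $$ (i, k) * x $ k) \<in> S"
      by (intro additive_subgroup_class_ring_sum[OF S]) simp
    then show ?thesis
      using M(1) \<open>dim_vec x = n\<close> \<open>i < m\<close> by (simp add: scalar_prod_def)
  qed
  then show ?thesis
    using mult_mat_vec_carrier[OF M(1)] x unfolding vecs_over_iff by blast
qed

section \<open>Partition regularity\<close>

lemma weakly_image_partition_regular_nonzero:
  assumes A: "A \<in> carrier_mat u v" and "u > 0" and "weakly_image_partition_regular A S"
  shows "A \<noteq> 0\<^sub>m u v"
proof
  assume "A = 0\<^sub>m u v"
  have "finite_colouring (\<lambda>_. 0) (S - {0})"
    by (auto simp: finite_colouring_def image_constant_conv)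
  then obtain x where "x \<in> vecs_over S v" "set\<^sub>v (A *\<^sub>v x) \<subseteq> S - {0}"
    using assms unfolding weakly_image_partition_regular_def by auto
  moreover have "(A *\<^sub>v x) $ 0 = 0"
    using \<open>A = 0\<^sub>m u v\<close> \<open>u > 0\<close> \<open>x \<in> vecs_over S v\<close> by (simp add: vecs_over_def)
  ultimately show False
    using vec_setI[of "A *\<^sub>v x" 0] A \<open>u > 0\<close> by auto
qed

lemma rows_linearly_dependent_single_row:
  assumes A: "A \<in> carrier_mat 1 v" and "rows_linearly_dependent A"
  shows "A = 0\<^sub>m 1 v"
proof -
  have "A $$ (0, k) = 0" if "k < v" for k
    using assms that by (auto simp: rows_linearly_dependent_def)
  then show ?thesis
    using A by (intro eq_matI) auto
qed

lemma weakly_image_partition_regular_compactness: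
  fixes r :: nat
  assumes "weakly_image_partition_regular A S"
  shows "\<exists>F \<subseteq> S - {0}. finite F \<and> (\<forall>c \<in> S - {0} \<rightarrow> {..<r}.
    \<exists>y \<in> vecs_over S (dim_col A). set\<^sub>v (A *\<^sub>v y) \<subseteq> F \<and> c constant_on set\<^sub>v (A *\<^sub>v y))"
proof -
  define \<A> where "\<A> = {E. E \<subseteq> S - {0} \<and> (\<exists>y \<in> vecs_over S (dim_col A). E = set\<^sub>v (A *\<^sub>v y))}"
  have images: "finite E \<and> E \<subseteq> S - {0}" if "E \<in> \<A>" for E
    using that by (auto simp: \<A>_def vec_set_def)
  have "\<exists>E\<in>\<A>. c constant_on E" if "c \<in> S - {0} \<rightarrow> {..<r}" for c
  proof -
    have "finite_colouring c (S - {0})"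
      using that unfolding finite_colouring_def
      by (intro finite_subset[OF _ finite_lessThan[of r]]) auto
    then obtain y where "y \<in> vecs_over S (dim_col A)" "set\<^sub>v (A *\<^sub>v y) \<subseteq> S - {0}"
      "monochromatic c (set\<^sub>v (A *\<^sub>v y))"
      using assms unfolding weakly_image_partition_regular_def by meson
    then show ?thesis
      unfolding \<A>_def monochromatic_def constant_on_def by auto
  qed
  from constant_on_compactness[OF finite_lessThan images this]
  obtain \<F> where \<F>: "finite \<F>" "\<F> \<subseteq> \<A>"
    and constant_on: "\<And>c. c \<in> S - {0} \<rightarrow> {..<r} \<Longrightarrow> \<exists>E\<in>\<F>. c constant_on E"
    by metis
  show ?thesis
  proof (intro exI[of _ "\<Union>\<F>"] conjI ballI)
    fix c assume "c \<in> S - {0} \<rightarrow> {..<r}"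
    then obtain E where "E \<in> \<F>" "c constant_on E"
      using constant_on by blast
    moreover from this obtain y where "y \<in> vecs_over S (dim_col A)" "E = set\<^sub>v (A *\<^sub>v y)"
      using \<F>(2) by (auto simp: \<A>_def)
    ultimately show "\<exists>y \<in> vecs_over S (dim_col A).
        set\<^sub>v (A *\<^sub>v y) \<subseteq> \<Union>\<F> \<and> c constant_on set\<^sub>v (A *\<^sub>v y)"
      by blast
  qed (use \<F> images in blast)+
qed

lemma weakly_image_partition_regular_dilated_images:
  assumes S: "additive_subgroup S (class_ring :: rat ring)"
    and regular: "weakly_image_partition_regular A S"
    and "finite_colouring c (S - {0})" and "d > 0"
  obtains y x t where "y \<in> vecs_over S (dim_col A)" "set\<^sub>v (A *\<^sub>v y) \<subseteq> S - {0}" "x > 0" "t > 0"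
    "monochromatic c (\<Union>n\<in>{d * t, x + t, x}. (\<lambda>e. of_nat n * e) ` set\<^sub>v (A *\<^sub>v y))"
proof -
  obtain r where "c ` (S - {0}) \<subseteq> {..<r}"
    using \<open>finite_colouring c (S - {0})\<close> unfolding finite_colouring_def
    by (metis finite_nat_iff_bounded)
  then have c_dilate: "c (of_nat n * e) < r" if "n > 0" "e \<in> S - {0}" for n :: nat and e
    using that additive_subgroup_class_ring_of_nat_mult[OF S] by (auto simp: image_subset_iff)
  obtain F where F: "F \<subseteq> S - {0}" "finite F" and constant_on: "\<forall>c \<in> S - {0} \<rightarrow> {..<r}.
      \<exists>y \<in> vecs_over S (dim_col A). set\<^sub>v (A *\<^sub>v y) \<subseteq> F \<and> c constant_on set\<^sub>v (A *\<^sub>v y)"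
    using weakly_image_partition_regular_compactness[OF regular] by meson
  have "finite ((\<lambda>n. c (of_nat n * e)) ` {0<..})" if "e \<in> F" for e
    using c_dilate F(1) that by (intro finite_subset[OF _ finite_lessThan[of r]]) auto
  then obtain x t where "x > 0" "t > 0" and same: "\<forall>e\<in>F. c (of_nat (x + t) * e) = c (of_nat x * e) \<and>
      c (of_nat (d * t) * e) = c (of_nat x * e)"
    using simultaneous_monochromatic_dilated_difference
      [OF F(2) _ \<open>d > 0\<close>, of "\<lambda>e n. c (of_nat n * e)"] by blast
  have "(\<lambda>e. c (of_nat x * e)) \<in> S - {0} \<rightarrow> {..<r}"
    using c_dilate[OF \<open>x > 0\<close>] by simp
  then obtain y where y: "y \<in> vecs_over S (dim_col A)" "set\<^sub>v (A *\<^sub>v y) \<subseteq> F"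
    and "(\<lambda>e. c (of_nat x * e)) constant_on set\<^sub>v (A *\<^sub>v y)"
    using constant_on by meson
  then obtain k where k: "\<And>e. e \<in> set\<^sub>v (A *\<^sub>v y) \<Longrightarrow> c (of_nat x * e) = k"
    by (auto simp: constant_on_def)
  have "c (of_nat n * e) = k" if "n \<in> {d * t, x + t, x}" "e \<in> set\<^sub>v (A *\<^sub>v y)" for n e
    using that same k[of e] y(2) by (auto simp del: of_nat_add of_nat_mult)
  then have "monochromatic c (\<Union>n\<in>{d * t, x + t, x}. (\<lambda>e. of_nat n * e) ` set\<^sub>v (A *\<^sub>v y))"
    unfolding monochromatic_def by blast
  with y F(1) \<open>x > 0\<close> \<open>t > 0\<close> show thesis
    by (intro that[of y x t]) auto
qed

lemma difference_extension_kernel_partition_regular: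
  assumes S: "additive_subgroup S (class_ring :: rat ring)"
    and A: "A \<in> carrier_mat u v" and N: "N \<in> carrier_mat j u"
    and NA: "\<And>y. y \<in> carrier_vec v \<Longrightarrow> N *\<^sub>v (A *\<^sub>v y) = 0\<^sub>v j"
    and regular: "weakly_image_partition_regular A S"
    and "d > 0"
  shows "kernel_partition_regular (difference_extension (of_nat d) N) S"
  unfolding kernel_partition_regular_def
proof (intro allI impI)
  let ?D = "difference_extension (of_nat d) N"
  fix c assume "finite_colouring c (S - {0})"
  then obtain y x t where y: "y \<in> vecs_over S v" "set\<^sub>v (A *\<^sub>v y) \<subseteq> S - {0}"
    and "x > 0" "t > 0" and dilates:
      "monochromatic c (\<Union>n\<in>{d * t, x + t, x}. (\<lambda>e. of_nat n * e) ` set\<^sub>v (A *\<^sub>v y))"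
    using weakly_image_partition_regular_dilated_images[OF S regular _ \<open>d > 0\<close>] A
    by (metis carrier_matD(2))
  have "y \<in> carrier_vec v"
    using y(1) by (simp add: vecs_over_def)
  then have Ay: "A *\<^sub>v y \<in> carrier_vec u"
    using A by simp
  define dilate where "dilate n = of_nat n \<cdot>\<^sub>v (A *\<^sub>v y)" for n :: nat
  have set_dilate: "set\<^sub>v (dilate n) = (\<lambda>e. of_nat n * e) ` set\<^sub>v (A *\<^sub>v y)" for n
    by (simp add: dilate_def vec_set_def image_image)
  have dilate_over: "dilate n \<in> vecs_over (S - {0}) u" if "n > 0" for n
    using that y(2) Ay additive_subgroup_class_ring_of_nat_mult[OF S]
    by (auto simp: vecs_over_def set_dilate) (auto simp: dilate_def)
  define s where "s = dilate (d * t) @\<^sub>v dilate (x + t) @\<^sub>v dilate x"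
  have "s \<in> vecs_over (S - {0}) (u + (u + u))"
    unfolding s_def using \<open>d > 0\<close> \<open>x > 0\<close> \<open>t > 0\<close>
    by (intro vecs_over_append dilate_over) auto
  then have "s \<in> vecs_over (S - {0}) (3 * u)"
    by (simp add: numeral_3_eq_3)
  moreover have "monochromatic c (set\<^sub>v s)"
    using dilates by (simp add: s_def vec_set_append set_dilate Un_assoc)
  moreover have "?D *\<^sub>v s = 0\<^sub>v (j + u)"
    using difference_extension_kernel_multiples[OF N Ay NA[OF \<open>y \<in> carrier_vec v\<close>]]
    by (simp add: s_def dilate_def)
  ultimately show "\<exists>x\<in>vecs_over (S - {0}) (dim_col ?D).
      ?D *\<^sub>v x = 0\<^sub>v (dim_row ?D) \<and> monochromatic c (set\<^sub>v x)"
    unfolding carrier_matD[OF difference_extension_carrier[OF N]] by blast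
qed

lemma difference_extension_solution_image:
  assumes S: "additive_subgroup S (class_ring :: rat ring)" and "u > 0"
    and A: "A \<in> carrier_mat u v" and B: "B \<in> carrier_mat v u"
    and integral: "elements_mat (d \<cdot>\<^sub>m B) \<subseteq> \<int>"
    and N: "N \<in> carrier_mat j u"
    and AB: "\<And>a. a \<in> carrier_vec u \<Longrightarrow> N *\<^sub>v a = 0\<^sub>v j \<Longrightarrow> A *\<^sub>v (B *\<^sub>v a) = a"
    and s: "s \<in> vecs_over (S - {0}) (3 * u)"
    and Ds: "difference_extension d N *\<^sub>v s = 0\<^sub>v (j + u)"
  shows "\<exists>y \<in> vecs_over S v - {0\<^sub>v v}. set\<^sub>v (A *\<^sub>v y) \<subseteq> set\<^sub>v s"
proof -
  have "s \<in> vecs_over (S - {0}) (u + (u + u))"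
    using s by (simp add: numeral_3_eq_3)
  then obtain a b c where s_eq: "s = a @\<^sub>v b @\<^sub>v c" and a: "a \<in> vecs_over (S - {0}) u"
    and b: "b \<in> vecs_over (S - {0}) u" and c: "c \<in> vecs_over (S - {0}) u"
    by (metis vecs_over_append_cases)
  have carrier: "a \<in> carrier_vec u" "b \<in> carrier_vec u" "c \<in> carrier_vec u"
    using a b c by (auto simp: vecs_over_def)
  have "N *\<^sub>v a = 0\<^sub>v j" and a_eq: "a = d \<cdot>\<^sub>v (b - c)"
    using Ds unfolding s_eq difference_extension_kernel_iff[OF N carrier] by blast+
  define y where "y = B *\<^sub>v a"
  have Ay: "A *\<^sub>v y = a"
    using AB carrier(1) \<open>N *\<^sub>v a = 0\<^sub>v j\<close> by (simp add: y_def)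
  have "b \<in> vecs_over S u" "c \<in> vecs_over S u"
    using b c by (auto simp: vecs_over_def)
  then have "(d \<cdot>\<^sub>m B) *\<^sub>v (b - c) \<in> vecs_over S v"
    using B integral by (intro vecs_over_int_mat_mult[OF S] vecs_over_diff[OF S]) auto
  moreover have "y = (d \<cdot>\<^sub>m B) *\<^sub>v (b - c)"
    using B carrier by (auto simp: y_def a_eq)
  ultimately have "y \<in> vecs_over S v"
    by simp
  moreover have "y \<noteq> 0\<^sub>v v"
  proof
    assume "y = 0\<^sub>v v"
    then have "a $ 0 = 0"
      using A \<open>u > 0\<close> by (simp flip: Ay)
    with a \<open>u > 0\<close> show False
      by (auto simp: vecs_over_iff)
  qed
  moreover have "set\<^sub>v (A *\<^sub>v y) \<subseteq> set\<^sub>v s"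
    by (simp add: Ay s_eq vec_set_append)
  ultimately show ?thesis
    by blast
qed

theorem theorem2p11:
  fixes S :: "rat set" and u v :: nat and A :: "rat mat"
  assumes "additive_subgroup S (class_ring :: rat ring)"
    and "S \<noteq> {0}" and "S \<noteq> UNIV"
    and "u > 0" and "v > 0"
    and "A \<in> carrier_mat u v"
    and "weakly_image_partition_regular A S"
    and "rows_linearly_dependent A"
  shows "\<exists>j D. 0 < j \<and> j < u \<and> D \<in> carrier_mat (j + u) (3 * u) \<and>
           kernel_partition_regular D S \<and>
           (\<forall>s \<in> vecs_over (S - {0}) (3 * u). D *\<^sub>v s = 0\<^sub>v (j + u) \<longrightarrow>
              (\<exists>y \<in> vecs_over S v - {0\<^sub>v v}. set\<^sub>v (A *\<^sub>v y) \<subseteq> set\<^sub>v s))"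
proof -
  note S = assms(1) and u = assms(4) and A = assms(6) and regular = assms(7)
  have "A \<noteq> 0\<^sub>m u v"
    by (rule weakly_image_partition_regular_nonzero[OF A u regular])
  then have "u \<noteq> 1"
    using rows_linearly_dependent_single_row A assms(8) by blast
  obtain B N where B: "B \<in> carrier_mat v u" and N: "N \<in> carrier_mat (u - 1) u"
    and NA: "\<And>y. y \<in> carrier_vec v \<Longrightarrow> N *\<^sub>v (A *\<^sub>v y) = 0\<^sub>v (u - 1)"
    and AB: "\<And>a. a \<in> carrier_vec u \<Longrightarrow> N *\<^sub>v a = 0\<^sub>v (u - 1) \<Longrightarrow> A *\<^sub>v (B *\<^sub>v a) = a"
    using column_space_as_kernel[OF A \<open>A \<noteq> 0\<^sub>m u v\<close>] by blast
  obtain d :: nat where "d > 0" and integral: "elements_mat (of_nat d \<cdot>\<^sub>m B) \<subseteq> \<int>"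
    by (rule integral_multiple_exists)
  define D where "D = difference_extension (of_nat d) N"
  have "kernel_partition_regular D S"
    unfolding D_def
    by (rule difference_extension_kernel_partition_regular[OF S A N NA regular \<open>d > 0\<close>])
  moreover have "D \<in> carrier_mat (u - 1 + u) (3 * u)"
    using difference_extension_carrier[OF N] by (simp add: D_def)
  moreover have "\<exists>y \<in> vecs_over S v - {0\<^sub>v v}. set\<^sub>v (A *\<^sub>v y) \<subseteq> set\<^sub>v s"
    if "s \<in> vecs_over (S - {0}) (3 * u)" "D *\<^sub>v s = 0\<^sub>v (u - 1 + u)" for s
    using that unfolding D_def
    by (intro difference_extension_solution_image[OF S u A B integral N AB])
  ultimately show ?thesis
    using u \<open>u \<noteq> 1\<close> by (intro exI[of _ "u - 1"] exI[of _ D]) auto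
qed

end
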